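(* Let $G$ be a topological group. Then $G$ is $P\mathbb{R}$-factorizable if and only if $G$ is feathered and $\mathbb{R}$-factorizable.
   Context: All topological spaces (in particular all topological groups) are assumed Hausdorff. A continuous map $f:X\to Y$ is perfect if it is closed, onto, and all fibers $f^{-1}(y)$ are compact; a perfect homomorphism is a continuous group homomorphism that is a perfect map. A topological group $G$ is feathered if it contains a non-empty compact set $K$ of countable character in $G$, i.e. there is a countable family of open sets containing $K$ such that every open set containing $K$ contains a member of the family. A topological group $G$ is $\mathbb{R}$-factorizable (respectively, $P\mathbb{R}$-factorizable) if for every continuous function $f:G\to\mathbb{R}$ there are a continuous (respectively, perfect) homomorphism $\pi:G\to H$ onto a second-countable topological group $H$ and a continuous function $g:H\to\mathbb{R}$ such that $f=g\circ\pi$. *)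

theory Defs
  imports "HOL-Analysis.Analysis" "HOL-Algebra.Coset"
begin

locale topological_group = group G for G (structure) +
  fixes T :: "'a topology"
  assumes topspace_eq: "topspace T = carrier G"
    and Hausdorff: "Hausdorff_space T"
    and continuous_mult: "continuous_map (prod_topology T T) T (\<lambda>(x, y). x \<otimes> y)"
    and continuous_inv: "continuous_map T T (\<lambda>x. inv x)"

definition countable_character_in :: "'a topology \<Rightarrow> 'a set \<Rightarrow> bool" where
  "countable_character_in T K \<longleftrightarrow>
     (\<exists>\<B>. countable \<B> \<and> (\<forall>U\<in>\<B>. openin T U \<and> K \<subseteq> U) \<and>
          (\<forall>V. openin T V \<and> K \<subseteq> V \<longrightarrow> (\<exists>U\<in>\<B>. U \<subseteq> V)))"

definition feathered :: "'a topology \<Rightarrow> bool" where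
  "feathered T \<longleftrightarrow> (\<exists>K. K \<noteq> {} \<and> compactin T K \<and> countable_character_in T K)"

definition second_countable_factorization ::
  "('a, 'm) monoid_scheme \<Rightarrow> 'a topology \<Rightarrow> ('a \<Rightarrow> real) \<Rightarrow>
   ('b, 'n) monoid_scheme \<Rightarrow> 'b topology \<Rightarrow> ('a \<Rightarrow> 'b) \<Rightarrow> ('b \<Rightarrow> real) \<Rightarrow> bool" where
  "second_countable_factorization G T f H S \<pi> g \<longleftrightarrow>
     topological_group H S \<and> second_countable S \<and>
     \<pi> \<in> hom G H \<and> continuous_map T S \<pi> \<and> \<pi> ` carrier G = carrier H \<and>
     continuous_map S euclideanreal g \<and> (\<forall>x\<in>carrier G. f x = g (\<pi> x))"

text \<open>HOL cannot quantify existentially over types, so the target group H below has elements of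
  type 'a set. This loses no generality: any homomorphic image of G is isomorphic to a quotient
  of G, whose elements are cosets. The lemma second_countable_factorization_on_cosets transfers
  a factorization through a group over an arbitrary type.\<close>

definition R_factorizable :: "('a, 'm) monoid_scheme \<Rightarrow> 'a topology \<Rightarrow> bool" where
  "R_factorizable G T \<longleftrightarrow>
     (\<forall>f. continuous_map T euclideanreal f \<longrightarrow>
        (\<exists>(H :: 'a set monoid) S \<pi> g. second_countable_factorization G T f H S \<pi> g))"

definition PR_factorizable :: "('a, 'm) monoid_scheme \<Rightarrow> 'a topology \<Rightarrow> bool" where
  "PR_factorizable G T \<longleftrightarrow>
     (\<forall>f. continuous_map T euclideanreal f \<longrightarrow>
        (\<exists>(H :: 'a set monoid) S \<pi> g.
           second_countable_factorization G T f H S \<pi> g \<and> perfect_map T S \<pi>))"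

lemma second_countable_factorization_on_cosets:
  fixes G :: "('a, 'm) monoid_scheme" and H :: "('b, 'n) monoid_scheme"
  assumes G: "topological_group G T"
    and fac: "second_countable_factorization G T f H S \<pi> g"
  shows "\<exists>(H' :: 'a set monoid) S' \<pi>' g'. second_countable_factorization G T f H' S' \<pi>' g' \<and>
           (perfect_map T S \<pi> \<longrightarrow> perfect_map T S' \<pi>')"
proof -
  have H: "topological_group H S" and sc: "second_countable S" and hom: "\<pi> \<in> hom G H"
    and cont: "continuous_map T S \<pi>" and onto: "\<pi> ` carrier G = carrier H"
    and g: "continuous_map S euclideanreal g" and f: "\<forall>x\<in>carrier G. f x = g (\<pi> x)"
    using fac by (auto simp: second_countable_factorization_def)
  interpret G: topological_group G T by fact
  interpret H: topological_group H S by fact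
  define \<phi> where "\<phi> = (\<lambda>y. {x \<in> carrier G. \<pi> x = y})"
  have inj: "inj_on \<phi> (carrier H)"
  proof (rule inj_onI)
    fix y z assume "y \<in> carrier H" "z \<in> carrier H" "\<phi> y = \<phi> z"
    then show "y = z" using onto unfolding \<phi>_def by (smt (verit) imageE mem_Collect_eq)
  qed
  define \<psi> where "\<psi> = inv_into (carrier H) \<phi>"
  have psi: "\<psi> (\<phi> y) = y" if "y \<in> carrier H" for y
    unfolding \<psi>_def using inj that by simp
  define H' :: "'a set monoid" where
    "H' = \<lparr>carrier = \<phi> ` carrier H, mult = (\<lambda>A B. \<phi> (\<psi> A \<otimes>\<^bsub>H\<^esub> \<psi> B)), one = \<phi> \<one>\<^bsub>H\<^esub>\<rparr>"
  have H': "carrier H' = \<phi> ` carrier H" "\<one>\<^bsub>H'\<^esub> = \<phi> \<one>\<^bsub>H\<^esub>"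
    "\<And>A B. A \<otimes>\<^bsub>H'\<^esub> B = \<phi> (\<psi> A \<otimes>\<^bsub>H\<^esub> \<psi> B)"
    by (auto simp: H'_def)
  define S' where "S' = pullback_topology (\<phi> ` carrier H) \<psi> S"
  have top': "topspace S' = \<phi> ` carrier H"
    unfolding S'_def topspace_pullback_topology using psi H.topspace_eq by auto
  have cpsi: "continuous_map S' S \<psi>"
    unfolding S'_def using continuous_map_pullback[of S S id] by (auto simp: comp_def id_def)
  have cphi: "continuous_map S S' \<phi>"
    unfolding S'_def
  proof (rule continuous_map_pullback')
    have "continuous_map S S (\<lambda>x. x)" by simp
    then show "continuous_map S S (\<psi> \<circ> \<phi>)"
      by (rule continuous_map_eq) (simp add: H.topspace_eq psi)
    show "topspace S \<subseteq> \<phi> -` \<phi> ` carrier H" using H.topspace_eq by auto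
  qed
  have homeo: "homeomorphic_maps S S' \<phi> \<psi>"
    unfolding homeomorphic_maps_def using cpsi cphi psi by (auto simp: top' H.topspace_eq)
  have hs: "S homeomorphic_space S'" using homeo homeomorphic_space_def by blast
  have hmap: "homeomorphic_map S S' \<phi>" using homeo homeomorphic_map_maps by blast
  have grp': "group H'"
  proof (rule groupI)
    fix x assume "x \<in> carrier H'"
    then obtain y where "y \<in> carrier H" "x = \<phi> y" by (auto simp: H')
    then show "\<exists>y\<in>carrier H'. y \<otimes>\<^bsub>H'\<^esub> x = \<one>\<^bsub>H'\<^esub>"
      by (intro bexI[of _ "\<phi> (inv\<^bsub>H\<^esub> y)"]) (auto simp: H' psi)
  qed (auto simp: H' psi H.m_assoc)
  interpret H': group H' by fact
  have inv': "inv\<^bsub>H'\<^esub> (\<phi> y) = \<phi> (inv\<^bsub>H\<^esub> y)" if "y \<in> carrier H" for y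
    using that by (intro H'.inv_equality) (auto simp: H' psi)
  have tg: "topological_group H' S'"
  proof
    show "topspace S' = carrier H'" by (simp add: top' H')
    show "Hausdorff_space S'" using hs H.Hausdorff homeomorphic_Hausdorff_space by blast
    have "continuous_map (prod_topology S' S') S' (\<phi> \<circ> (\<lambda>(x,y). x \<otimes>\<^bsub>H\<^esub> y) \<circ> (\<lambda>(x,y). (\<psi> x, \<psi> y)))"
      by (rule continuous_map_compose[OF _ continuous_map_compose[OF H.continuous_mult cphi]])
         (simp add: continuous_map_prod_top cpsi)
    then show "continuous_map (prod_topology S' S') S' (\<lambda>(x,y). x \<otimes>\<^bsub>H'\<^esub> y)"
      by (rule continuous_map_eq) (auto simp: H')
    have "continuous_map S' S' (\<phi> \<circ> (\<lambda>x. inv\<^bsub>H\<^esub> x) \<circ> \<psi>)"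
      by (rule continuous_map_compose[OF cpsi continuous_map_compose[OF H.continuous_inv cphi]])
    then show "continuous_map S' S' (\<lambda>x. inv\<^bsub>H'\<^esub> x)"
      by (rule continuous_map_eq) (auto simp: top' psi inv')
  qed
  have "second_countable_factorization G T f H' S' (\<phi> \<circ> \<pi>) (g \<circ> \<psi>)"
    unfolding second_countable_factorization_def
  proof (intro conjI)
    show "second_countable S'" using hs sc homeomorphic_space_second_countability by blast
    show "\<phi> \<circ> \<pi> \<in> hom G H'"
      using hom onto by (auto simp: hom_def H' psi Pi_iff)
    show "continuous_map T S' (\<phi> \<circ> \<pi>)" using cont cphi by (rule continuous_map_compose)
    show "(\<phi> \<circ> \<pi>) ` carrier G = carrier H'" unfolding image_comp[symmetric] onto H'(1) ..
    show "continuous_map S' euclideanreal (g \<circ> \<psi>)" using cpsi g by (rule continuous_map_compose)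
    show "\<forall>x\<in>carrier G. f x = (g \<circ> \<psi>) ((\<phi> \<circ> \<pi>) x)" using f psi by (simp flip: onto)
  qed (fact tg)
  moreover have "perfect_map T S' (\<phi> \<circ> \<pi>)" if "perfect_map T S \<pi>"
    using that homeomorphic_imp_perfect_map[OF hmap] by (rule perfect_map_compose)
  ultimately show ?thesis by blast
qed

end

theory Submission
  imports Defs
begin

text \<open>A perfect homomorphism onto a second-countable group makes its kernel a compact set of
  countable character. Conversely, let K be compact with a countable base of neighbourhoods.
  A Birkhoff--Kakutani chain construction gives a continuous function h that vanishes on K and
  whose sublevel sets shrink to K. If h factors through a continuous homomorphism onto a Hausdorff
  group, then one fibre lies in K, and the homomorphism turns out to be perfect. So factor
  both f and h and take the diagonal of the two homomorphisms.\<close>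

text \<open>A discrete intermediate value argument: \<open>b\<close> is where the partial sums pass
  \<open>c\<close>. As long as the head does not exceed \<open>c\<close>, subtracting its weight
  keeps the threshold nonnegative and the induction goes on.\<close>

lemma sum_list_split_at:
  fixes w :: "'b \<Rightarrow> real"
  assumes "0 \<le> c" "c < sum_list (map w ps)"
  shows "\<exists>as b bs. ps = as @ b # bs \<and> sum_list (map w as) \<le> c \<and> c < sum_list (map w as) + w b"
  using assms
proof (induction ps arbitrary: c)
  case (Cons p ps)
  show ?case
  proof (cases "c < w p")
    case True
    with Cons.prems show ?thesis by (intro exI[of _ "[]"]) auto
  next
    case False
    with Cons.IH[of "c - w p"] Cons.prems obtain as b bs where
      "ps = as @ b # bs" "sum_list (map w as) \<le> c - w p" "c - w p < sum_list (map w as) + w b"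
      by auto
    then show ?thesis by (intro exI[of _ "p # as"]) auto
  qed
qed simp

section \<open>Neighbourhoods of the identity and of compact sets\<close>

context topological_group
begin

lemma continuous_map_left_translation:
  assumes "a \<in> carrier G"
  shows "continuous_map T T (\<lambda>x. a \<otimes> x)"
proof -
  have "continuous_map T (prod_topology T T) (\<lambda>x. (a, x))"
    using assms by (simp add: continuous_map_paired topspace_eq)
  from continuous_map_compose[OF this continuous_mult] show ?thesis by (simp add: comp_def)
qed

lemma openin_left_translation_preimage:
  assumes "a \<in> carrier G" "openin T U"
  shows "openin T {x \<in> carrier G. a \<otimes> x \<in> U}"
  using openin_continuous_map_preimage[OF continuous_map_left_translation] assms
  by (simp add: topspace_eq)

text \<open>Multiplication pulls \<open>U\<close> back to an open set around
  \<open>K \<times> {\<one>}\<close>; both factors are compact, so Wallace's theorem fits an open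
  box in between.\<close>

lemma compact_mult_nbhd_one:
  assumes K: "compactin T K" and U: "openin T U" "K \<subseteq> U"
  shows "\<exists>V. openin T V \<and> \<one> \<in> V \<and> (\<forall>k\<in>K. \<forall>v\<in>V. k \<otimes> v \<in> U)"
proof -
  have KG: "K \<subseteq> carrier G" using compactin_subset_topspace[OF K] by (simp add: topspace_eq)
  define W where "W = {p \<in> topspace (prod_topology T T). (case p of (x, y) \<Rightarrow> x \<otimes> y) \<in> U}"
  have "openin (prod_topology T T) W"
    unfolding W_def by (rule openin_continuous_map_preimage[OF continuous_mult U(1)])
  moreover have "K \<times> {\<one>} \<subseteq> W" using KG U(2) by (auto simp: W_def topspace_eq subset_iff)
  moreover have "compactin T {\<one>}" by (simp add: topspace_eq)
  ultimately obtain A V where V: "openin T V" "{\<one>} \<subseteq> V" and "K \<subseteq> A" "A \<times> V \<subseteq> W"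
    using K by (metis Wallace_theorem_prod_topology)
  have kv: "k \<otimes> v \<in> U" if "k \<in> K" "v \<in> V" for k v
  proof -
    have "(k, v) \<in> W" using that \<open>K \<subseteq> A\<close> \<open>A \<times> V \<subseteq> W\<close> by blast
    then show ?thesis by (simp add: W_def)
  qed
  show ?thesis using V kv by (intro exI[of _ V]) auto
qed

text \<open>Continuity at \<open>(\<one>, \<one>)\<close> is used twice. Three factors are needed
  because a chain will be cut into two outer parts and a middle factor.\<close>

lemma triple_product_nbhd_one:
  assumes U: "openin T U" "\<one> \<in> U"
  shows "\<exists>V. openin T V \<and> \<one> \<in> V \<and> (\<forall>a\<in>V. \<forall>b\<in>V. \<forall>c\<in>V. a \<otimes> (b \<otimes> c) \<in> U)"
proof -
  have *: "\<exists>V. openin T V \<and> \<one> \<in> V \<and> (\<forall>a\<in>V. \<forall>b\<in>V. a \<otimes> b \<in> U)"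
    if U: "openin T U" "\<one> \<in> U" for U
  proof -
    define W where "W = {p \<in> topspace (prod_topology T T). (case p of (x, y) \<Rightarrow> x \<otimes> y) \<in> U}"
    have "openin (prod_topology T T) W"
      unfolding W_def by (rule openin_continuous_map_preimage[OF continuous_mult U(1)])
    moreover have "(\<one>, \<one>) \<in> W" using U by (auto simp: W_def topspace_eq)
    ultimately obtain A B where AB: "openin T A" "openin T B" "\<one> \<in> A" "\<one> \<in> B" "A \<times> B \<subseteq> W"
      unfolding openin_prod_topology_alt by meson
    have "\<forall>a\<in>A \<inter> B. \<forall>b\<in>A \<inter> B. a \<otimes> b \<in> U"
      using AB(5) by (auto simp: W_def subset_iff)
    then show ?thesis using AB by (intro exI[of _ "A \<inter> B"]) auto
  qed
  obtain V1 where V1: "openin T V1" "\<one> \<in> V1" "\<forall>a\<in>V1. \<forall>b\<in>V1. a \<otimes> b \<in> U" using *[OF U] by blast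
  obtain V2 where V2: "openin T V2" "\<one> \<in> V2" "\<forall>a\<in>V2. \<forall>b\<in>V2. a \<otimes> b \<in> V1"
    using *[OF V1(1,2)] by blast
  show ?thesis using V1 V2 by (intro exI[of _ "V1 \<inter> V2"]) auto
qed

text \<open>Intersect \<open>V\<close> with its preimage under inversion. Symmetry later allows a
  step from one point to another to be retraced.\<close>

lemma symmetric_nbhd_one:
  assumes V: "openin T V" "\<one> \<in> V"
  shows "\<exists>W. openin T W \<and> \<one> \<in> W \<and> W \<subseteq> V \<and> (\<forall>x\<in>W. inv x \<in> W)"
proof -
  have "openin T {x \<in> topspace T. inv x \<in> V}"
    by (rule openin_continuous_map_preimage[OF continuous_inv V(1)])
  moreover have "V \<subseteq> carrier G" using openin_subset[OF V(1)] by (simp add: topspace_eq)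
  ultimately show ?thesis
    using V by (intro exI[of _ "V \<inter> {x \<in> topspace T. inv x \<in> V}"]) (auto simp: topspace_eq subset_iff)
qed

section \<open>Chains of small elements and their weights\<close>

definition chain_prod :: "('a \<times> nat) list \<Rightarrow> 'a" where
  "chain_prod ps = foldr (\<lambda>p y. fst p \<otimes> y) ps \<one>"

definition chain_weight :: "('a \<times> nat) list \<Rightarrow> real" where
  "chain_weight ps = (\<Sum>p\<leftarrow>ps. (1/2) ^ snd p)"

text \<open>Each factor carries a declared level, because an element may lie in many of the sets
  \<open>V n\<close> and the weight is charged for the chosen one.\<close>

definition chains :: "(nat \<Rightarrow> 'a set) \<Rightarrow> ('a \<times> nat) list set" where
  "chains V = {ps. \<forall>p\<in>set ps. fst p \<in> V (snd p)}"

lemma chain_weight_nonneg: "0 \<le> chain_weight ps"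
  unfolding chain_weight_def by (induction ps) auto

lemma chain_prod_closed:
  assumes "\<And>n. V n \<subseteq> carrier G" "ps \<in> chains V"
  shows "chain_prod ps \<in> carrier G"
  using assms(2) assms(1)[THEN subsetD] by (induction ps) (auto simp: chains_def chain_prod_def)

lemma chain_prod_append:
  assumes "\<And>n. V n \<subseteq> carrier G" "ps \<in> chains V" "qs \<in> chains V"
  shows "chain_prod (ps @ qs) = chain_prod ps \<otimes> chain_prod qs"
  using assms(2)
proof (induction ps)
  case Nil
  show ?case using chain_prod_closed[OF assms(1,3)] by (simp add: chain_prod_def)
next
  case (Cons p ps)
  have ps: "ps \<in> chains V" and p: "fst p \<in> carrier G"
    using Cons.prems assms(1)[of "snd p"] by (auto simp: chains_def)
  have "chain_prod ((p # ps) @ qs) = fst p \<otimes> (chain_prod ps \<otimes> chain_prod qs)"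
    using Cons.IH[OF ps] by (simp add: chain_prod_def)
  also have "\<dots> = (fst p \<otimes> chain_prod ps) \<otimes> chain_prod qs"
    using p chain_prod_closed[OF assms(1) ps] chain_prod_closed[OF assms(1,3)]
    by (simp add: m_assoc)
  finally show ?case by (simp add: chain_prod_def)
qed

text \<open>Cut a chain of weight s at the factor where the partial sums pass s/2: the two
  outer parts weigh at most s/2 and the middle factor at most s.\<close>
lemma chain_prod_in_nbhd:
  assumes V: "\<And>n. V n \<subseteq> carrier G" "\<And>n. \<one> \<in> V n"
    and triple: "\<And>n a b c. \<lbrakk>a \<in> V (Suc n); b \<in> V (Suc n); c \<in> V (Suc n)\<rbrakk> \<Longrightarrow> a \<otimes> (b \<otimes> c) \<in> V n"
  shows "ps \<in> chains V \<Longrightarrow> chain_weight ps < (1/2) ^ n \<Longrightarrow> chain_prod ps \<in> V n"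
proof (induction ps arbitrary: n rule: length_induct)
  case (1 ps)
  \<comment> \<open>Padding with the identity, \<open>x \<otimes> (\<one> \<otimes> \<one>)\<close>,
    turns the triple product condition into monotonicity.\<close>
  have mono: "V m \<subseteq> V n" if "n \<le> m" for m n
  proof (rule decseqD[OF _ that])
    show "decseq V"
    proof (rule decseq_SucI, rule subsetI)
      fix k x assume "x \<in> V (Suc k)"
      then show "x \<in> V k" using triple[of x k \<one> \<one>] V by (auto simp: subset_iff)
    qed
  qed
  show ?case
  proof (cases "ps = []")
    case True
    then show ?thesis using V by (simp add: chain_prod_def)
  next
    case False
    let ?s = "chain_weight ps"
    \<comment> \<open>Positivity makes half the weight strictly smaller than the whole, as the
      cutting lemma demands.\<close>
    have spos: "0 < ?s"
      using False chain_weight_nonneg[of "tl ps"]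
      by (cases ps) (auto simp: chain_weight_def intro!: add_pos_nonneg)
    then obtain as b bs where ps: "ps = as @ b # bs"
      and as: "chain_weight as \<le> ?s / 2" "?s / 2 < chain_weight as + (1/2) ^ snd b"
      using sum_list_split_at[of "?s / 2" "\<lambda>p. (1/2) ^ snd p" ps]
      unfolding chain_weight_def by auto
    have s: "?s = chain_weight as + (1/2) ^ snd b + chain_weight bs"
      unfolding ps by (simp add: chain_weight_def)
    have mem: "as \<in> chains V" "bs \<in> chains V" "[b] \<in> chains V" "b # bs \<in> chains V"
      and b: "fst b \<in> V (snd b)"
      using "1.prems"(1) by (auto simp: chains_def ps)
    \<comment> \<open>Both outer parts weigh at most half of \<open>?s\<close>, the second because
      the cut factor already carries the sum past half. They are shorter than \<open>ps\<close>, so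
      the induction hypothesis applies one level deeper.\<close>
    have half: "?s / 2 < (1/2) ^ Suc n" using "1.prems"(2) by simp
    have "chain_prod as \<in> V (Suc n)" using "1.IH" mem as half by (auto simp: ps)
    moreover have "chain_prod bs \<in> V (Suc n)" using "1.IH" mem as half s by (auto simp: ps)
    moreover have "fst b \<in> V (Suc n)"
    proof -
      \<comment> \<open>The middle factor is bounded only by the full weight, without halving. But
        levels are integers, so a weight strictly below \<open>(1/2) ^ n\<close> forces level at
        least \<open>Suc n\<close>.\<close>
      have "(1/2 :: real) ^ snd b < (1/2) ^ n"
        using s chain_weight_nonneg[of as] chain_weight_nonneg[of bs] "1.prems"(2) by linarith
      then have "n < snd b" by (simp add: power_strict_decreasing_iff)
      then show ?thesis using b mono[of "Suc n" "snd b"] by auto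
    qed
    ultimately have "chain_prod as \<otimes> (fst b \<otimes> chain_prod bs) \<in> V n" using triple by blast
    moreover have "chain_prod ps = chain_prod as \<otimes> chain_prod (b # bs)"
      unfolding ps using chain_prod_append[OF V(1) mem(1,4)] .
    ultimately show ?thesis by (simp add: chain_prod_def)
  qed
qed

section \<open>A continuous function measuring the distance from a compact set\<close>

text \<open>The value at x is the least weight of a chain leading from K to x, as in the proof of the
  Birkhoff--Kakutani theorem.\<close>
lemma exists_continuous_measuring_compact:
  fixes U :: "nat \<Rightarrow> 'a set"
  assumes K: "compactin T K" "K \<noteq> {}" and U: "\<And>n. openin T (U n)" "\<And>n. K \<subseteq> U n"
  shows "\<exists>h. continuous_map T euclideanreal h \<and> (\<forall>x\<in>K. h x = 0) \<and>
             (\<forall>n. \<exists>\<epsilon>>0. \<forall>x\<in>carrier G. h x < \<epsilon> \<longrightarrow> x \<in> U n)"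
proof -
  have KG: "K \<subseteq> carrier G" using compactin_subset_topspace[OF K(1)] by (simp add: topspace_eq)
  \<comment> \<open>Level 0 is the whole group, so that every element can be reached from
    \<open>K\<close> by a single factor and the infimum below is over a nonempty set.\<close>
  define P where "P = (\<lambda>n V. openin T V \<and> \<one> \<in> V \<and> (\<forall>x\<in>V. inv x \<in> V) \<and> (n = (0::nat) \<longrightarrow> V = carrier G))"
  define Q where "Q = (\<lambda>n V W. (\<forall>a\<in>W. \<forall>b\<in>W. \<forall>c\<in>W. a \<otimes> (b \<otimes> c) \<in> V) \<and>
                               (\<forall>k\<in>K. \<forall>v\<in>W. k \<otimes> v \<in> U n))"
  have "\<exists>V. \<forall>n. P n (V n) \<and> Q n (V n) (V (Suc n))"
  proof (rule dependent_nat_choice)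
    have "openin T (carrier G)" using openin_topspace[of T] by (simp add: topspace_eq)
    then show "\<exists>V. P 0 V" by (auto simp: P_def)
  next
    fix V and n :: nat assume "P n V"
    then have V: "openin T V" "\<one> \<in> V" by (auto simp: P_def)
    obtain A where A: "openin T A" "\<one> \<in> A" "\<forall>a\<in>A. \<forall>b\<in>A. \<forall>c\<in>A. a \<otimes> (b \<otimes> c) \<in> V"
      using triple_product_nbhd_one[OF V] by blast
    obtain B where B: "openin T B" "\<one> \<in> B" "\<forall>k\<in>K. \<forall>v\<in>B. k \<otimes> v \<in> U n"
      using compact_mult_nbhd_one[OF K(1) U] by blast
    have "openin T (A \<inter> B)" "\<one> \<in> A \<inter> B" using A B by auto
    then obtain W where W: "openin T W" "\<one> \<in> W" "W \<subseteq> A \<inter> B" "\<forall>x\<in>W. inv x \<in> W"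
      using symmetric_nbhd_one by metis
    have "P (Suc n) W" using W by (simp add: P_def)
    moreover have "Q n V W" unfolding Q_def using A(3) B(3) W(3) by blast
    ultimately show "\<exists>W. P (Suc n) W \<and> Q n V W" by blast
  qed
  then obtain V where PV: "\<And>n. P n (V n)" and QV: "\<And>n. Q n (V n) (V (Suc n))" by blast
  have V: "\<And>n. openin T (V n)" "\<And>n. \<one> \<in> V n" "\<And>n x. x \<in> V n \<Longrightarrow> inv x \<in> V n" "V 0 = carrier G"
    using PV by (auto simp: P_def)
  have VG: "V n \<subseteq> carrier G" for n using openin_subset[OF V(1)] by (simp add: topspace_eq)
  have triple: "a \<otimes> (b \<otimes> c) \<in> V n" if "a \<in> V (Suc n)" "b \<in> V (Suc n)" "c \<in> V (Suc n)" for n a b c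
    using QV that unfolding Q_def by blast
  have KV: "k \<otimes> v \<in> U n" if "k \<in> K" "v \<in> V (Suc n)" for n k v
    using QV that unfolding Q_def by blast
  define D where "D = (\<lambda>x. {chain_weight ps | ps. ps \<in> chains V \<and> (\<exists>k\<in>K. x = k \<otimes> chain_prod ps)})"
  \<comment> \<open>Outside the carrier \<open>D x\<close> is empty and its infimum unspecified;
    only values on the carrier matter.\<close>
  define h where "h = (\<lambda>x. Inf (D x))"
  have bdd: "bdd_below (D x)" for x
    using chain_weight_nonneg by (auto simp: D_def intro!: bdd_belowI[of _ 0])
  have ne: "D x \<noteq> {}" if x: "x \<in> carrier G" for x
  proof -
    obtain k where k: "k \<in> K" using K(2) by blast
    then have "k \<in> carrier G" using KG by blast
    \<comment> \<open>One factor on level 0 leads from \<open>k\<close> to \<open>x\<close>, at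
      weight 1.\<close>
    then have "x = k \<otimes> chain_prod [(inv k \<otimes> x, 0)]" "[(inv k \<otimes> x, 0)] \<in> chains V"
      using x by (auto simp: chain_prod_def chains_def V(4) inv_solve_left m_assoc[symmetric])
    then show ?thesis using k unfolding D_def by blast
  qed
  have h0: "h x = 0" if "x \<in> K" for x
  proof -
    \<comment> \<open>The empty chain, of weight 0, leads from \<open>x\<close> to itself.\<close>
    have "[] \<in> chains V" "x = x \<otimes> chain_prod []" using that KG by (auto simp: chains_def chain_prod_def)
    then have "chain_weight [] \<in> D x" using that unfolding D_def by blast
    then have "h x \<le> 0" unfolding h_def using cInf_lower[OF _ bdd] by (simp add: chain_weight_def)
    moreover have "0 \<le> h x" unfolding h_def
      by (rule cInf_greatest) (use ne that KG chain_weight_nonneg in \<open>auto simp: D_def\<close>)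
    ultimately show ?thesis by simp
  qed
  \<comment> \<open>Appending \<open>(y, n)\<close> to any chain ending at \<open>x\<close> gives a
    chain ending at \<open>x \<otimes> y\<close> that costs \<open>(1/2) ^ n\<close> more; then pass
    to the infimum.\<close>
  have step: "h (x \<otimes> y) \<le> h x + (1/2) ^ n" if x: "x \<in> carrier G" and y: "y \<in> V n" for x y n
  proof -
    have "h (x \<otimes> y) - (1/2) ^ n \<le> d" if "d \<in> D x" for d
    proof -
      from that obtain ps k where ps: "d = chain_weight ps" "ps \<in> chains V" "k \<in> K"
        "x = k \<otimes> chain_prod ps" by (auto simp: D_def)
      have yG: "y \<in> carrier G" using y VG by blast
      have y': "[(y, n)] \<in> chains V" using y by (simp add: chains_def)
      then have "chain_prod (ps @ [(y, n)]) = chain_prod ps \<otimes> y"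
        using chain_prod_append[OF VG ps(2) y'] yG by (simp add: chain_prod_def)
      then have "x \<otimes> y = k \<otimes> chain_prod (ps @ [(y, n)])"
        using ps(3,4) KG yG chain_prod_closed[OF VG ps(2)] by (auto simp: m_assoc)
      moreover have "ps @ [(y, n)] \<in> chains V" using ps(2) y by (auto simp: chains_def)
      ultimately have "chain_weight (ps @ [(y, n)]) \<in> D (x \<otimes> y)" using ps(3) unfolding D_def by blast
      then have "h (x \<otimes> y) \<le> chain_weight (ps @ [(y, n)])"
        unfolding h_def by (rule cInf_lower[OF _ bdd])
      then show ?thesis by (simp add: ps(1) chain_weight_def)
    qed
    then have "h (x \<otimes> y) - (1/2) ^ n \<le> Inf (D x)"
      using ne[OF x] by (intro cInf_greatest)
    then show ?thesis by (simp add: h_def)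
  qed
  have close: "\<bar>h z - h x\<bar> \<le> (1/2) ^ n"
    if x: "x \<in> carrier G" and z: "z \<in> carrier G" and xz: "inv x \<otimes> z \<in> V n" for x z n
  proof -
    have "x \<otimes> (inv x \<otimes> z) = z" using x z by (simp add: m_assoc[symmetric])
    with step[OF x xz] have "h z \<le> h x + (1/2) ^ n" by simp
    \<comment> \<open>Symmetry of \<open>V n\<close> allows the way back: the inverse of
      \<open>inv x \<otimes> z\<close> leads from \<open>z\<close> to \<open>x\<close>.\<close>
    moreover have "z \<otimes> inv (inv x \<otimes> z) = x"
      using x z by (simp add: inv_mult_group m_assoc[symmetric])
    with step[OF z V(3)[OF xz]] have "h x \<le> h z + (1/2) ^ n" by simp
    ultimately show ?thesis by linarith
  qed
  have "continuous_map T euclideanreal h"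
    unfolding continuous_map_def
  proof (intro conjI allI impI)
    fix A assume "openin euclideanreal A"
    then have A: "open A" by simp
    show "openin T {x \<in> topspace T. h x \<in> A}"
    proof (subst openin_subopen, intro ballI)
      fix x assume "x \<in> {x \<in> topspace T. h x \<in> A}"
      then have x: "x \<in> carrier G" "h x \<in> A" by (auto simp: topspace_eq)
      obtain e where e: "e > 0" "\<And>r. dist r (h x) < e \<Longrightarrow> r \<in> A"
        using A x(2) unfolding open_dist by blast
      obtain n where n: "(1/2 :: real) ^ n < e" using real_arch_pow_inv[OF e(1), of "1/2"] by auto
      \<comment> \<open>The left translate of \<open>V n\<close> by \<open>x\<close>; there
        \<open>h\<close> differs from \<open>h x\<close> by at most \<open>(1/2) ^ n\<close>, which
        is less than \<open>e\<close>.\<close>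
      let ?W = "{z \<in> carrier G. inv x \<otimes> z \<in> V n}"
      have "openin T ?W" using openin_left_translation_preimage[of "inv x" "V n"] x V(1) by simp
      moreover have "x \<in> ?W" using x V(2) by simp
      moreover have "?W \<subseteq> {x \<in> topspace T. h x \<in> A}"
        using e(2) close[OF x(1)] n by (fastforce simp: topspace_eq dist_real_def)
      ultimately show "\<exists>W. openin T W \<and> x \<in> W \<and> W \<subseteq> {x \<in> topspace T. h x \<in> A}" by blast
    qed
  qed auto
  moreover have "\<exists>\<epsilon>>0. \<forall>x\<in>carrier G. h x < \<epsilon> \<longrightarrow> x \<in> U n" for n
  \<comment> \<open>The exponent is \<open>Suc n\<close> because chains lighter than this have
    product in \<open>V (Suc n)\<close>, and \<open>K\<close> times that set lies in
    \<open>U n\<close>.\<close>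
  proof (rule exI[of _ "(1/2) ^ Suc n"], rule conjI)
    show "\<forall>x\<in>carrier G. h x < (1/2) ^ Suc n \<longrightarrow> x \<in> U n"
    proof (intro ballI impI)
      fix x assume x: "x \<in> carrier G" and hx: "h x < (1/2) ^ Suc n"
      obtain d where "d \<in> D x" "d < (1/2) ^ Suc n"
        using hx cInf_lessD[OF ne[OF x]] unfolding h_def by blast
      then obtain ps k where ps: "ps \<in> chains V" "k \<in> K" "x = k \<otimes> chain_prod ps"
        "chain_weight ps < (1/2) ^ Suc n" by (auto simp: D_def)
      then show "x \<in> U n" using KV chain_prod_in_nbhd[OF VG V(2) triple ps(1,4)] by blast
    qed
  qed simp
  ultimately show ?thesis using h0 by blast
qed

text \<open>Enumerating a countable neighbourhood base of \<open>K\<close> turns the bounds for the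
  single \<open>U n\<close> into one for every open \<open>V\<close> around \<open>K\<close>: pass
  to a member of the base inside \<open>V\<close>.\<close>

lemma feathered_measuring_function:
  assumes "feathered T"
  obtains K h where "compactin T K" "K \<noteq> {}" "continuous_map T euclideanreal h" "\<forall>x\<in>K. h x = 0"
    "\<And>V. openin T V \<Longrightarrow> K \<subseteq> V \<Longrightarrow> \<exists>\<epsilon>>0. \<forall>x\<in>carrier G. h x < \<epsilon> \<longrightarrow> x \<in> V"
proof -
  obtain K where K: "compactin T K" "K \<noteq> {}" and char: "countable_character_in T K"
    using assms unfolding feathered_def by blast
  obtain \<B> where \<B>: "countable \<B>" "\<forall>U\<in>\<B>. openin T U \<and> K \<subseteq> U"
    "\<forall>V. openin T V \<and> K \<subseteq> V \<longrightarrow> (\<exists>U\<in>\<B>. U \<subseteq> V)"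
    using char unfolding countable_character_in_def by (elim exE conjE)
  \<comment> \<open>The whole space is an open set around \<open>K\<close>, so the base has a
    member; its enumeration by all naturals requires one.\<close>
  have "\<B> \<noteq> {}" using \<B>(3) openin_topspace compactin_subset_topspace[OF K(1)] by blast
  then have rng: "range (from_nat_into \<B>) = \<B>" using \<B>(1) by (simp add: range_from_nat_into)
  then have "\<And>n. openin T (from_nat_into \<B> n)" "\<And>n. K \<subseteq> from_nat_into \<B> n"
    using \<B>(2) by blast+
  from exists_continuous_measuring_compact[of K "from_nat_into \<B>", OF K this] obtain h where
    h: "continuous_map T euclideanreal h" "\<forall>x\<in>K. h x = 0"
       "\<And>n. \<exists>\<epsilon>>0. \<forall>x\<in>carrier G. h x < \<epsilon> \<longrightarrow> x \<in> from_nat_into \<B> n" by metis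
  have "\<exists>\<epsilon>>0. \<forall>x\<in>carrier G. h x < \<epsilon> \<longrightarrow> x \<in> V" if V: "openin T V" "K \<subseteq> V" for V
  proof -
    obtain U where U: "U \<in> \<B>" "U \<subseteq> V" using \<B>(3) V by blast
    then obtain n where "U = from_nat_into \<B> n" using rng by (metis rangeE)
    then show ?thesis using h(3)[of n] U(2) by blast
  qed
  with K h(1,2) show ?thesis using that by blast
qed

end

section \<open>Subgroups, products and joint factorizations\<close>

lemma topological_group_subgroup:
  assumes "topological_group G T" "subgroup A G"
  shows "topological_group (G\<lparr>carrier := A\<rparr>) (subtopology T A)"
proof -
  interpret topological_group G T by fact
  interpret A: group "G\<lparr>carrier := A\<rparr>" using assms(2) subgroup.subgroup_is_group is_group by blast
  have AG: "A \<subseteq> carrier G" by (rule subgroup.subset[OF assms(2)])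
  show ?thesis
  proof
    show "topspace (subtopology T A) = carrier (G\<lparr>carrier := A\<rparr>)" using AG by (auto simp: topspace_eq)
    show "Hausdorff_space (subtopology T A)" using Hausdorff by (rule Hausdorff_space_subtopology)
    have "continuous_map (subtopology (prod_topology T T) (A \<times> A)) (subtopology T A) (\<lambda>(x, y). x \<otimes>\<^bsub>G\<^esub> y)"
      using continuous_map_from_subtopology[OF continuous_mult] subgroup.m_closed[OF assms(2)]
      by (auto simp: continuous_map_in_subtopology)
    then show "continuous_map (prod_topology (subtopology T A) (subtopology T A)) (subtopology T A)
        (\<lambda>(x, y). x \<otimes>\<^bsub>G\<lparr>carrier := A\<rparr>\<^esub> y)"
      by (simp add: subtopology_Times)
    have "continuous_map (subtopology T A) (subtopology T A) (\<lambda>x. inv\<^bsub>G\<^esub> x)"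
      using continuous_map_from_subtopology[OF continuous_inv] subgroup.m_inv_closed[OF assms(2)]
      by (auto simp: continuous_map_in_subtopology)
    then show "continuous_map (subtopology T A) (subtopology T A) (\<lambda>x. inv\<^bsub>G\<lparr>carrier := A\<rparr>\<^esub> x)"
      by (rule continuous_map_eq) (use assms(2) in auto)
  qed
qed

lemma topological_group_DirProd:
  assumes "topological_group G T" "topological_group H S"
  shows "topological_group (G \<times>\<times> H) (prod_topology T S)"
proof -
  interpret G: topological_group G T by fact
  interpret H: topological_group H S by fact
  interpret P: group "G \<times>\<times> H" using G.is_group H.is_group by (rule DirProd_group)
  let ?P = "prod_topology T S"
  show ?thesis
  proof
    show "topspace ?P = carrier (G \<times>\<times> H)" by (simp add: G.topspace_eq H.topspace_eq DirProd_def)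
    show "Hausdorff_space ?P" using G.Hausdorff H.Hausdorff by (simp add: Hausdorff_space_prod_topology)
    have fst2: "continuous_map (prod_topology ?P ?P) (prod_topology T T) (\<lambda>p. (fst (fst p), fst (snd p)))"
     and snd2: "continuous_map (prod_topology ?P ?P) (prod_topology S S) (\<lambda>p. (snd (fst p), snd (snd p)))"
      using continuous_map_compose[OF continuous_map_fst continuous_map_fst]
        continuous_map_compose[OF continuous_map_snd continuous_map_fst]
        continuous_map_compose[OF continuous_map_fst continuous_map_snd]
        continuous_map_compose[OF continuous_map_snd continuous_map_snd]
      unfolding continuous_map_paired comp_def by blast+
    have "continuous_map (prod_topology ?P ?P) ?P
       (\<lambda>p. (fst (fst p) \<otimes>\<^bsub>G\<^esub> fst (snd p), snd (fst p) \<otimes>\<^bsub>H\<^esub> snd (snd p)))"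
      using continuous_map_compose[OF fst2 G.continuous_mult]
        continuous_map_compose[OF snd2 H.continuous_mult]
      by (simp add: continuous_map_paired comp_def)
    then show "continuous_map (prod_topology ?P ?P) ?P (\<lambda>(x, y). x \<otimes>\<^bsub>G \<times>\<times> H\<^esub> y)"
      by (rule continuous_map_eq) (auto simp: DirProd_def)
    have "continuous_map ?P ?P (\<lambda>p. (inv\<^bsub>G\<^esub> (fst p), inv\<^bsub>H\<^esub> (snd p)))"
      using continuous_map_compose[OF continuous_map_fst G.continuous_inv]
        continuous_map_compose[OF continuous_map_snd H.continuous_inv]
      unfolding continuous_map_paired comp_def by blast
    then show "continuous_map ?P ?P (\<lambda>x. inv\<^bsub>G \<times>\<times> H\<^esub> x)"
      by (rule continuous_map_eq)
        (auto simp: G.topspace_eq H.topspace_eq inv_DirProd[OF G.is_group H.is_group])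
  qed
qed

lemma second_countable_prod_topology:
  assumes "second_countable X" "second_countable Y"
  shows "second_countable (prod_topology X Y)"
proof -
  obtain \<A> where A: "countable \<A>" "\<And>U. U \<in> \<A> \<Longrightarrow> openin X U"
    "\<And>U x. openin X U \<Longrightarrow> x \<in> U \<Longrightarrow> \<exists>V\<in>\<A>. x \<in> V \<and> V \<subseteq> U"
    using assms(1) unfolding second_countable_def by metis
  obtain \<B> where B: "countable \<B>" "\<And>U. U \<in> \<B> \<Longrightarrow> openin Y U"
    "\<And>U x. openin Y U \<Longrightarrow> x \<in> U \<Longrightarrow> \<exists>V\<in>\<B>. x \<in> V \<and> V \<subseteq> U"
    using assms(2) unfolding second_countable_def by metis
  show ?thesis
    unfolding second_countable_def
  proof (intro exI conjI ballI allI impI)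
    show "countable ((\<lambda>(a, b). a \<times> b) ` (\<A> \<times> \<B>))" using A(1) B(1) by simp
    show "openin (prod_topology X Y) V" if "V \<in> (\<lambda>(a, b). a \<times> b) ` (\<A> \<times> \<B>)" for V
      using that A(2) B(2) by (auto simp: openin_prod_Times_iff)
    fix U p assume "openin (prod_topology X Y) U \<and> p \<in> U"
    then obtain a b where "openin X a" "openin Y b" "fst p \<in> a" "snd p \<in> b" "a \<times> b \<subseteq> U"
      unfolding openin_prod_topology_alt by (metis prod.collapse)
    moreover then obtain a' b' where "a' \<in> \<A>" "fst p \<in> a'" "a' \<subseteq> a" "b' \<in> \<B>" "snd p \<in> b'" "b' \<subseteq> b"
      using A(3) B(3) by metis
    ultimately show "\<exists>V\<in>(\<lambda>(a, b). a \<times> b) ` (\<A> \<times> \<B>). p \<in> V \<and> V \<subseteq> U"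
      by (intro bexI[of _ "a' \<times> b'"]) (auto simp: mem_Times_iff)
  qed
qed

text \<open>The diagonal map into the product group carries both factorizations at once, and each
  function is recovered through a projection. The target is cut down to the image, since a
  factorization must be onto.\<close>

lemma second_countable_factorization_joint:
  fixes H1 :: "('b, 'm) monoid_scheme" and H2 :: "('c, 'n) monoid_scheme"
  assumes "topological_group G T"
    and f: "second_countable_factorization G T f H1 S1 \<pi>1 g1"
    and h: "second_countable_factorization G T h H2 S2 \<pi>2 g2"
  obtains H :: "('b \<times> 'c) monoid" and S \<pi>
  where "second_countable_factorization G T f H S \<pi> (g1 \<circ> fst)"
    "second_countable_factorization G T h H S \<pi> (g2 \<circ> snd)"
proof -
  interpret G: topological_group G T by fact
  have 1: "topological_group H1 S1" "second_countable S1" "\<pi>1 \<in> hom G H1" "continuous_map T S1 \<pi>1"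
    "continuous_map S1 euclideanreal g1" "\<forall>x\<in>carrier G. f x = g1 (\<pi>1 x)"
    and 2: "topological_group H2 S2" "second_countable S2" "\<pi>2 \<in> hom G H2" "continuous_map T S2 \<pi>2"
    "continuous_map S2 euclideanreal g2" "\<forall>x\<in>carrier G. h x = g2 (\<pi>2 x)"
    using f h by (auto simp: second_countable_factorization_def)
  define \<pi> where "\<pi> = (\<lambda>x. (\<pi>1 x, \<pi>2 x))"
  define A where "A = \<pi> ` carrier G"
  define H where "H = (H1 \<times>\<times> H2)\<lparr>carrier := A\<rparr>"
  define S where "S = subtopology (prod_topology S1 S2) A"
  interpret P: topological_group "H1 \<times>\<times> H2" "prod_topology S1 S2"
    using 1(1) 2(1) by (rule topological_group_DirProd)
  have hom: "\<pi> \<in> hom G (H1 \<times>\<times> H2)"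
    using 1(3) 2(3) by (auto simp: \<pi>_def hom_def DirProd_def)
  then have "group_hom G (H1 \<times>\<times> H2) \<pi>" by unfold_locales
  then have "subgroup A (H1 \<times>\<times> H2)" unfolding A_def by (rule group_hom.img_is_subgroup)
  then have "topological_group H S"
    unfolding H_def S_def by (rule topological_group_subgroup[OF P.topological_group_axioms])
  moreover have "second_countable S"
    unfolding S_def using 1(2) 2(2)
    by (intro second_countable_subtopology second_countable_prod_topology)
  moreover have "\<pi> \<in> hom G H" using hom by (auto simp: hom_def H_def A_def)
  moreover have "continuous_map T S \<pi>"
    using 1(4) 2(4) G.topspace_eq
    by (auto simp: S_def continuous_map_in_subtopology continuous_map_paired \<pi>_def A_def)
  moreover have "\<pi> ` carrier G = carrier H" by (simp add: H_def A_def)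
  moreover have "continuous_map S euclideanreal (g1 \<circ> fst)" "continuous_map S euclideanreal (g2 \<circ> snd)"
    unfolding S_def using 1(5) 2(5)
    by (blast intro: continuous_map_from_subtopology continuous_map_compose continuous_map_fst
        continuous_map_snd)+
  moreover have "\<forall>x\<in>carrier G. f x = (g1 \<circ> fst) (\<pi> x)" "\<forall>x\<in>carrier G. h x = (g2 \<circ> snd) (\<pi> x)"
    using 1(6) 2(6) by (auto simp: \<pi>_def)
  ultimately show ?thesis using that unfolding second_countable_factorization_def by blast
qed

section \<open>Perfect maps and compact fibres of countable character\<close>

text \<open>The fibre through a point of K lies in K, and its saturated neighbourhoods form a base
  because h controls how far they leave K. Translations carry this to every other fibre.\<close>
lemma perfect_map_of_measuring_factorization:
  assumes G: "topological_group G T"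
    and fac: "second_countable_factorization G T h H S \<pi> g"
    and K: "compactin T K" "K \<noteq> {}" and h0: "\<forall>x\<in>K. h x = 0"
    and small: "\<And>V. openin T V \<Longrightarrow> K \<subseteq> V \<Longrightarrow> \<exists>\<epsilon>>0. \<forall>x\<in>carrier G. h x < \<epsilon> \<longrightarrow> x \<in> V"
  shows "perfect_map T S \<pi>"
proof -
  interpret G: topological_group G T by fact
  have H: "topological_group H S" and hom: "\<pi> \<in> hom G H" and cont: "continuous_map T S \<pi>"
    and onto: "\<pi> ` carrier G = carrier H" and g: "continuous_map S euclideanreal g"
    and hg: "\<forall>x\<in>carrier G. h x = g (\<pi> x)"
    using fac by (auto simp: second_countable_factorization_def)
  interpret H: topological_group H S by fact
  interpret group_hom G H \<pi> using hom by unfold_locales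
  have KG: "K \<subseteq> carrier G" using compactin_subset_topspace[OF K(1)] by (simp add: G.topspace_eq)
  obtain k where k: "k \<in> K" using K(2) by blast
  have kG: "k \<in> carrier G" using k KG by blast
  have gk: "g (\<pi> k) = 0" using hg h0 k kG by auto
  let ?F = "\<lambda>y. {x \<in> topspace T. \<pi> x = y}"
  \<comment> \<open>\<open>h\<close> factors through \<open>\<pi>\<close>, so it vanishes on the
    whole fibre. Removing a fibre point outside \<open>K\<close> from the space would leave an open
    set around \<open>K\<close> that must contain every point where \<open>h\<close> is small, a
    contradiction.\<close>
  have FK: "?F (\<pi> k) \<subseteq> K"
  proof (rule subsetI, rule ccontr)
    fix x assume x: "x \<in> ?F (\<pi> k)" "x \<notin> K"
    have "openin T (topspace T - {x})"
      using Hausdorff_imp_t1_space[OF G.Hausdorff] x by (intro openin_diff) (auto simp: t1_space_closedin_singleton)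
    moreover have "K \<subseteq> topspace T - {x}" using x KG by (auto simp: G.topspace_eq)
    ultimately obtain e where "e > 0" "\<forall>z\<in>carrier G. h z < e \<longrightarrow> z \<in> topspace T - {x}"
      using small[of "topspace T - {x}"] by blast
    moreover have "h x = 0" using x hg gk by (simp add: G.topspace_eq)
    ultimately show False using x by (auto simp: G.topspace_eq)
  qed
  have Fk: "compactin T (?F (\<pi> k))"
  proof (rule closed_compactin[OF K(1) FK])
    have "closedin S {\<pi> k}"
      using Hausdorff_imp_t1_space[OF H.Hausdorff] kG by (simp add: t1_space_closedin_singleton H.topspace_eq)
    from closedin_continuous_map_preimage[OF cont this] show "closedin T (?F (\<pi> k))" by simp
  qed
  have base: "\<exists>W. openin S W \<and> \<pi> k \<in> W \<and> {x \<in> topspace T. \<pi> x \<in> W} \<subseteq> U"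
    if U: "openin T U" "?F (\<pi> k) \<subseteq> U" for U
  proof -
    \<comment> \<open>\<open>U\<close> need not contain \<open>K\<close>. The part of
      \<open>K\<close> outside \<open>U\<close> is compact and its image misses
      \<open>\<pi> k\<close>, so the two can be separated in \<open>S\<close>; adding the preimage
      of \<open>W'\<close> to \<open>U\<close> then covers \<open>K\<close>.\<close>
    have "compactin T (K - U)"
      using closedin_diff[OF compactin_imp_closedin[OF G.Hausdorff K(1)] U(1)]
      by (intro closed_compactin[OF K(1)]) auto
    then have "compactin S (\<pi> ` (K - U))" using cont by (rule image_compactin)
    moreover have "disjnt {\<pi> k} (\<pi> ` (K - U))"
      using U(2) KG by (auto simp: disjnt_def G.topspace_eq)
    moreover have "compactin S {\<pi> k}" using kG by (simp add: H.topspace_eq)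
    ultimately obtain W W' where W: "openin S W" "openin S W'" "\<pi> k \<in> W" "\<pi> ` (K - U) \<subseteq> W'" "disjnt W W'"
      using H.Hausdorff unfolding Hausdorff_space_compact_sets by (metis insert_subset)
    let ?V = "U \<union> {x \<in> topspace T. \<pi> x \<in> W'}"
    have "openin T ?V" using U(1) openin_continuous_map_preimage[OF cont W(2)] by blast
    moreover have "K \<subseteq> ?V" using W(4) KG by (auto simp: G.topspace_eq)
    ultimately obtain e where e: "e > 0" "\<forall>x\<in>carrier G. h x < e \<longrightarrow> x \<in> ?V" using small by metis
    \<comment> \<open>Over \<open>?W\<close>, the bound \<open>h < e\<close> puts a point in
      \<open>?V\<close>, and disjointness of \<open>W\<close> and \<open>W'\<close> leaves only
      \<open>U\<close>.\<close>
    let ?W = "W \<inter> {y \<in> topspace S. g y \<in> {..<e}}"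
    have "openin S {y \<in> topspace S. g y \<in> {..<e}}"
      by (rule openin_continuous_map_preimage[OF g]) simp
    then have "openin S ?W" using W(1) by blast
    moreover have "\<pi> k \<in> ?W" using W(3) gk e(1) kG by (simp add: H.topspace_eq)
    moreover have "{x \<in> topspace T. \<pi> x \<in> ?W} \<subseteq> U"
      using e(2) hg W(5) by (auto simp: G.topspace_eq disjnt_def)
    ultimately show ?thesis by blast
  qed
  have "compactin T (?F y)" if y: "y \<in> topspace S" for y
  proof -
    obtain a where a: "a \<in> carrier G" "y = \<pi> a"
      using y onto by (metis H.topspace_eq imageE)
    \<comment> \<open>Left translation by \<open>c\<close> carries the fibre over
      \<open>\<pi> k\<close> to the fibre over \<open>y\<close>.\<close>
    define c where "c = a \<otimes>\<^bsub>G\<^esub> inv\<^bsub>G\<^esub> k"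
    have c: "c \<in> carrier G" "\<pi> c \<otimes>\<^bsub>H\<^esub> \<pi> k = y"
    proof -
      show "c \<in> carrier G" using a kG by (simp add: c_def)
      have "c \<otimes>\<^bsub>G\<^esub> k = a" using a kG by (simp add: c_def G.m_assoc)
      with \<open>c \<in> carrier G\<close> show "\<pi> c \<otimes>\<^bsub>H\<^esub> \<pi> k = y" using a(2) kG by (simp flip: hom_mult)
    qed
    have "?F y = (\<lambda>x. c \<otimes>\<^bsub>G\<^esub> x) ` ?F (\<pi> k)"
    proof (intro equalityI subsetI)
      fix x assume x: "x \<in> ?F y"
      then have xG: "x \<in> carrier G" by (simp add: G.topspace_eq)
      have "x = c \<otimes>\<^bsub>G\<^esub> (inv\<^bsub>G\<^esub> c \<otimes>\<^bsub>G\<^esub> x)" using xG c by (simp add: G.m_assoc[symmetric])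
      moreover have "\<pi> (inv\<^bsub>G\<^esub> c \<otimes>\<^bsub>G\<^esub> x) = \<pi> k"
        using x xG c(1) kG c(2)[symmetric] by (simp add: H.m_assoc[symmetric])
      ultimately show "x \<in> (\<lambda>x. c \<otimes>\<^bsub>G\<^esub> x) ` ?F (\<pi> k)"
        using xG c(1) by (auto simp: G.topspace_eq)
    qed (use c in \<open>auto simp: G.topspace_eq\<close>)
    then show ?thesis using image_compactin[OF Fk G.continuous_map_left_translation[OF c(1)]] by simp
  qed
  moreover have "closed_map T S \<pi>"
    \<comment> \<open>For a map into \<open>S\<close>, closedness means that each open set around a
      fibre contains the preimage of an open set around its base point.\<close>
    unfolding closed_map_fibre_neighbourhood
  proof (intro conjI allI impI)
    show "\<pi> \<in> topspace T \<rightarrow> topspace S" by (auto simp: G.topspace_eq H.topspace_eq)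
    fix U y assume U: "openin T U \<and> y \<in> topspace S \<and> ?F y \<subseteq> U"
    then have "y \<in> topspace S" by blast
    then obtain a where a: "a \<in> carrier G" "y = \<pi> a"
      using onto by (metis H.topspace_eq imageE)
    define c where "c = a \<otimes>\<^bsub>G\<^esub> inv\<^bsub>G\<^esub> k"
    have c: "c \<in> carrier G" "\<pi> c \<otimes>\<^bsub>H\<^esub> \<pi> k = y"
    proof -
      show "c \<in> carrier G" using a kG by (simp add: c_def)
      have "c \<otimes>\<^bsub>G\<^esub> k = a" using a kG by (simp add: c_def G.m_assoc)
      with \<open>c \<in> carrier G\<close> show "\<pi> c \<otimes>\<^bsub>H\<^esub> \<pi> k = y" using a(2) kG by (simp flip: hom_mult)
    qed
    have yH: "y \<in> carrier H" using a by simp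
    have cy: "inv\<^bsub>H\<^esub> (\<pi> c) \<otimes>\<^bsub>H\<^esub> y = \<pi> k" using c kG by (simp add: H.m_assoc[symmetric] flip: c(2))
    \<comment> \<open>\<open>U\<close> is translated back to the fibre over \<open>\<pi> k\<close>,
      where \<open>base\<close> applies; the resulting \<open>W\<close> is then moved to
      \<open>y\<close> by \<open>\<pi> c\<close>.\<close>
    let ?U = "{x \<in> carrier G. c \<otimes>\<^bsub>G\<^esub> x \<in> U}"
    have "openin T ?U" using G.openin_left_translation_preimage[OF c(1)] U by blast
    moreover have "?F (\<pi> k) \<subseteq> ?U" using U c by (auto simp: G.topspace_eq)
    ultimately obtain W where W: "openin S W" "\<pi> k \<in> W" "{x \<in> topspace T. \<pi> x \<in> W} \<subseteq> ?U"
      using base by metis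
    let ?W = "{z \<in> carrier H. inv\<^bsub>H\<^esub> (\<pi> c) \<otimes>\<^bsub>H\<^esub> z \<in> W}"
    have "openin S ?W" using H.openin_left_translation_preimage W(1) c(1) by simp
    moreover have "y \<in> ?W" using cy W(2) yH by simp
    moreover have "x \<in> U" if x: "x \<in> topspace T" "\<pi> x \<in> ?W" for x
    proof -
      have xG: "x \<in> carrier G" using x(1) by (simp add: G.topspace_eq)
      have "\<pi> (inv\<^bsub>G\<^esub> c \<otimes>\<^bsub>G\<^esub> x) \<in> W" using x(2) xG c(1) by simp
      moreover have "inv\<^bsub>G\<^esub> c \<otimes>\<^bsub>G\<^esub> x \<in> topspace T" using xG c(1) by (simp add: G.topspace_eq)
      ultimately have "inv\<^bsub>G\<^esub> c \<otimes>\<^bsub>G\<^esub> x \<in> ?U" using W(3) by blast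
      moreover have "c \<otimes>\<^bsub>G\<^esub> (inv\<^bsub>G\<^esub> c \<otimes>\<^bsub>G\<^esub> x) = x" using xG c(1) by (simp add: G.m_assoc[symmetric])
      ultimately show ?thesis by simp
    qed
    ultimately show "\<exists>V. openin S V \<and> y \<in> V \<and> {x \<in> topspace T. \<pi> x \<in> V} \<subseteq> U" by blast
  qed
  ultimately show ?thesis
    unfolding perfect_map_def proper_map_def using cont onto by (simp add: G.topspace_eq H.topspace_eq)
qed

text \<open>Any fibre serves: it is compact, and closedness of \<open>\<pi>\<close> makes the
  preimages of a local base at \<open>y\<close> a neighbourhood base of the fibre over
  \<open>y\<close>.\<close>

lemma feathered_of_perfect_map:
  assumes "perfect_map T S \<pi>" "first_countable S" "topspace S \<noteq> {}"
  shows "feathered T"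
proof -
  obtain y where y: "y \<in> topspace S" using assms(3) by blast
  obtain \<B> where B: "countable \<B>" "\<And>V. V \<in> \<B> \<Longrightarrow> openin S V"
    "\<And>U. openin S U \<Longrightarrow> y \<in> U \<Longrightarrow> \<exists>V\<in>\<B>. y \<in> V \<and> V \<subseteq> U"
    using assms(2) y unfolding first_countable_def by metis
  have cont: "continuous_map T S \<pi>" and closed: "closed_map T S \<pi>"
    and onto: "\<pi> ` topspace T = topspace S" and fib: "compactin T {x \<in> topspace T. \<pi> x = y}"
    using assms(1) y by (auto simp: perfect_map_def proper_map_def)
  \<comment> \<open>\<open>\<B>\<close> may have members that miss \<open>y\<close>; their preimages
    do not contain the fibre and are discarded.\<close>
  define \<C> where "\<C> = (\<lambda>V. {x \<in> topspace T. \<pi> x \<in> V}) ` {V \<in> \<B>. y \<in> V}"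
  have "countable_character_in T {x \<in> topspace T. \<pi> x = y}"
    unfolding countable_character_in_def
  proof (intro exI[of _ \<C>] conjI ballI allI impI)
    show "countable \<C>" using B(1) by (simp add: \<C>_def)
    fix U assume "U \<in> \<C>"
    then show "openin T U" "{x \<in> topspace T. \<pi> x = y} \<subseteq> U"
      using B(2) openin_continuous_map_preimage[OF cont] by (auto simp: \<C>_def)
  next
    fix V assume "openin T V \<and> {x \<in> topspace T. \<pi> x = y} \<subseteq> V"
    then obtain W where "openin S W" "y \<in> W" "{x \<in> topspace T. \<pi> x \<in> W} \<subseteq> V"
      using closed y unfolding closed_map_fibre_neighbourhood by meson
    moreover then obtain W' where "W' \<in> \<B>" "y \<in> W'" "W' \<subseteq> W" using B(3) by blast
    ultimately show "\<exists>U\<in>\<C>. U \<subseteq> V"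
      unfolding \<C>_def by (intro bexI[of _ "{x \<in> topspace T. \<pi> x \<in> W'}"]) auto
  qed
  moreover have "{x \<in> topspace T. \<pi> x = y} \<noteq> {}" using y unfolding onto[symmetric] by auto
  ultimately show ?thesis
    unfolding feathered_def using fib by (intro exI[of _ "{x \<in> topspace T. \<pi> x = y}"] conjI)
qed

theorem corollary3p5:
  fixes G :: "('a, 'm) monoid_scheme" and T :: "'a topology"
  assumes "topological_group G T"
  shows "PR_factorizable G T \<longleftrightarrow> feathered T \<and> R_factorizable G T"
proof
  assume PR: "PR_factorizable G T"
  then have "R_factorizable G T" unfolding PR_factorizable_def R_factorizable_def by blast
  moreover have "feathered T"
  proof -
    \<comment> \<open>Any continuous function would do; the constant one yields a perfect
      homomorphism onto a second-countable group.\<close>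
    have "continuous_map T euclideanreal (\<lambda>x. 0)" by simp
    then obtain H :: "'a set monoid" and S \<pi> g where
      fac: "second_countable_factorization G T (\<lambda>x. 0) H S \<pi> g" and perf: "perfect_map T S \<pi>"
      using PR unfolding PR_factorizable_def by blast
    interpret H: topological_group H S using fac by (simp add: second_countable_factorization_def)
    have "first_countable S"
      using fac by (simp add: second_countable_factorization_def second_countable_imp_first_countable)
    moreover have "topspace S \<noteq> {}" using H.one_closed unfolding H.topspace_eq by blast
    ultimately show ?thesis using perf by (intro feathered_of_perfect_map)
  qed
  ultimately show "feathered T \<and> R_factorizable G T" by blast
next
  assume *: "feathered T \<and> R_factorizable G T"
  interpret topological_group G T by fact
  obtain K h where K: "compactin T K" "K \<noteq> {}" and h: "continuous_map T euclideanreal h" "\<forall>x\<in>K. h x = 0"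
    "\<And>V. openin T V \<Longrightarrow> K \<subseteq> V \<Longrightarrow> \<exists>\<epsilon>>0. \<forall>x\<in>carrier G. h x < \<epsilon> \<longrightarrow> x \<in> V"
    using feathered_measuring_function * by metis
  show "PR_factorizable G T"
    unfolding PR_factorizable_def
  proof (intro allI impI)
    fix f assume f: "continuous_map T euclideanreal f"
    obtain H1 :: "'a set monoid" and S1 \<pi>1 g1 where 1: "second_countable_factorization G T f H1 S1 \<pi>1 g1"
      using * f unfolding R_factorizable_def by blast
    obtain H2 :: "'a set monoid" and S2 \<pi>2 g2 where 2: "second_countable_factorization G T h H2 S2 \<pi>2 g2"
      using * h(1) unfolding R_factorizable_def by blast
    obtain H :: "('a set \<times> 'a set) monoid" and S \<pi>
      where fac: "second_countable_factorization G T f H S \<pi> (g1 \<circ> fst)"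
      "second_countable_factorization G T h H S \<pi> (g2 \<circ> snd)"
      by (rule second_countable_factorization_joint[OF assms 1 2])
    \<comment> \<open>Perfectness comes from the factorization of \<open>h\<close>; \<open>f\<close>
      factors through the same \<open>\<pi>\<close>.\<close>
    have "perfect_map T S \<pi>"
      by (rule perfect_map_of_measuring_factorization[OF assms fac(2) K h(2,3)])
    \<comment> \<open>\<open>H\<close> consists of pairs of sets, so the factorization is moved to a
      group over the type \<open>'a set\<close>, keeping perfectness.\<close>
    then show "\<exists>(H :: 'a set monoid) S \<pi> g.
        second_countable_factorization G T f H S \<pi> g \<and> perfect_map T S \<pi>"
      using second_countable_factorization_on_cosets[OF assms fac(1)] by blast
  qed
qed

end
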